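(* Let $G$ be a finite simple graph and let $X = X_1 \cap \dots \cap X_k$ ($k \ge 1$), where each $X_i$ is a maximum independent set of $G$. Then \[ \alpha(G) \le \mu(G) + |X| - \mu(G[N_G[X]]), \] and this bound is sharp (there exist graphs and such sets $X$ attaining equality).
   Context: $\alpha(G)$ is the independence number (maximum size of an independent set) and $\mu(G)$ is the matching number (maximum size of a matching). For $X \subseteq V(G)$, $N_G[X] = X \cup \bigcup_{v \in X} N_G(v)$ is the closed neighborhood of $X$, and $G[S]$ denotes the subgraph induced by $S$; the matching number of a graph with no edges (or no vertices) is $0$. *)

theory Defs
  imports "HOL-Library.Ramsey" "HOL-Library.Disjoint_Sets"
begin

text \<open>
  A graph is given by its vertex set \<open>V\<close> and its edge set \<open>E\<close>, where an edge is a
  two-element set of vertices (so loops and parallel edges are excluded).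
\<close>

definition finite_simple_graph :: "'a set \<Rightarrow> 'a set set \<Rightarrow> bool" where
  "finite_simple_graph V E \<longleftrightarrow> finite V \<and> E \<subseteq> nsets V 2"

definition independent_set :: "'a set \<Rightarrow> 'a set set \<Rightarrow> 'a set \<Rightarrow> bool" where
  "independent_set V E S \<longleftrightarrow> S \<subseteq> V \<and> indep S E"

text \<open>
  The maxima in the two definitions below are over finite nonempty sets of numbers whenever
  \<open>finite_simple_graph V E\<close> holds, since the empty set is both independent and a matching.
\<close>

definition independence_number :: "'a set \<Rightarrow> 'a set set \<Rightarrow> nat" where
  "independence_number V E = Max (card ` {S. independent_set V E S})"

definition maximum_independent_set :: "'a set \<Rightarrow> 'a set set \<Rightarrow> 'a set \<Rightarrow> bool" where
  "maximum_independent_set V E S \<longleftrightarrow>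
     independent_set V E S \<and> card S = independence_number V E"

definition matching :: "'a set set \<Rightarrow> 'a set set \<Rightarrow> bool" where
  "matching E M \<longleftrightarrow> M \<subseteq> E \<and> disjoint M"

definition matching_number :: "'a set set \<Rightarrow> nat" where
  "matching_number E = Max (card ` {M. matching E M})"

definition neighborhood :: "'a set set \<Rightarrow> 'a \<Rightarrow> 'a set" where
  "neighborhood E v = {u. {v, u} \<in> E}"

definition closed_neighborhood :: "'a set set \<Rightarrow> 'a set \<Rightarrow> 'a set" where
  "closed_neighborhood E X = X \<union> (\<Union>v\<in>X. neighborhood E v)"

text \<open>
  The edge set of the subgraph induced by \<open>S\<close>. Its vertex set is \<open>S\<close> itself, which
  plays no role for the matching number.
\<close>

definition induced_edges :: "'a set set \<Rightarrow> 'a set \<Rightarrow> 'a set set" where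
  "induced_edges E S = {e \<in> E. e \<subseteq> S}"

end

theory Submission
  imports Defs
begin

text \<open>
  Every vertex of a maximum independent set \<open>S\<close> containing \<open>X\<close> that is not in \<open>X\<close> lies outside
  the closed neighborhood of \<open>X\<close>. It therefore suffices to match \<open>S\<^sub>1 - X\<close> into \<open>\<Union>i. S\<^sub>i\<close>: such a
  matching can be added to a maximum matching of \<open>G[N[X]]\<close>. Hall's condition holds because, for
  independent \<open>A\<close>, maximality of \<open>S\<^sub>i\<close> gives \<open>|N(A - S\<^sub>i) \<inter> S\<^sub>i| \<ge> |A - S\<^sub>i|\<close>, while \<open>N(A \<inter> S\<^sub>i)\<close>
  avoids \<open>S\<^sub>i\<close>; so one can pass from \<open>A\<close> to \<open>A \<inter> S\<^sub>i\<close> and treat the sets \<open>S\<^sub>i\<close> one after another.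
\<close>

text \<open>Halmos-Vaughan induction on the size of \<open>I\<close>. If some nonempty proper
  subfamily is tight (its union has as many elements as it has indices), the problem splits into
  that subfamily and the rest. Otherwise every such subfamily has an element to spare, and one
  representative may be chosen freely.\<close>

theorem hall_marriage:
  fixes F :: "'i \<Rightarrow> 'b set"
  assumes "finite I"
    and "\<And>i. i \<in> I \<Longrightarrow> finite (F i)"
    and "\<And>J. J \<subseteq> I \<Longrightarrow> card J \<le> card (\<Union>(F ` J))"
  shows "\<exists>f. inj_on f I \<and> (\<forall>i\<in>I. f i \<in> F i)"
  using assms
proof (induction "card I" arbitrary: I F rule: less_induct)
  case (less I F)
  note fin = less.prems(1) and finF = less.prems(2) and hall = less.prems(3)
  show ?case
  proof (cases "I = {}")
    case True
    then show ?thesis by simp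
  next
    case False
    show ?thesis
    proof (cases "\<exists>J. J \<subset> I \<and> J \<noteq> {} \<and> card (\<Union>(F ` J)) = card J")
      case True
      then obtain J where J: "J \<subset> I" "J \<noteq> {}" "card (\<Union>(F ` J)) = card J" by blast
      define U where "U = \<Union>(F ` J)"
      have finJ: "finite J" using J(1) fin finite_subset by blast
      have "card J < card I" using J(1) fin by (simp add: psubset_card_mono)
      then obtain f where f: "inj_on f J" "\<forall>i\<in>J. f i \<in> F i"
        using less.hyps[of J F] finJ finF hall J(1) by blast
      have "card (I - J) < card I"
        using J fin by (intro psubset_card_mono) auto
      \<comment> \<open>Hall's condition survives the deletion of \<open>U\<close>: apply it to
        \<open>K \<union> J\<close> and cancel \<open>card J\<close> against \<open>card U\<close>,
        which are equal by tightness.\<close>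
      moreover have "card K \<le> card (\<Union>((\<lambda>i. F i - U) ` K))" if K: "K \<subseteq> I - J" for K
      proof -
        have finK: "finite K" using K fin finite_subset by blast
        have finU: "finite U" unfolding U_def using J(1) finJ finF by auto
        have "card K + card J = card (K \<union> J)"
          using K finK finJ by (subst card_Un_disjoint) auto
        also have "\<dots> \<le> card (\<Union>(F ` (K \<union> J)))"
          using K J(1) by (intro hall) auto
        also have "\<Union>(F ` (K \<union> J)) = \<Union>((\<lambda>i. F i - U) ` K) \<union> U"
          unfolding U_def by auto
        also have "card \<dots> \<le> card (\<Union>((\<lambda>i. F i - U) ` K)) + card U"
          by (rule card_Un_le)
        finally show ?thesis using J(3) by (simp add: U_def)
      qed
      ultimately obtain g where g: "inj_on g (I - J)" "\<forall>i\<in>I - J. g i \<in> F i - U"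
        using less.hyps[of "I - J" "\<lambda>i. F i - U"] fin finF by blast
      let ?h = "\<lambda>i. if i \<in> J then f i else g i"
      have mem: "\<forall>i\<in>I. ?h i \<in> F i" using f g by auto
      have "f i \<in> U" if "i \<in> J" for i using f(2) that unfolding U_def by auto
      then have "f i \<noteq> g j" if "i \<in> J" "j \<in> I - J" for i j using g(2) that by fastforce
      then have "inj_on ?h I"
        using f(1) g(1) unfolding inj_on_def by (metis DiffI)
      with mem show ?thesis by blast
    next
      case noneTight: False
      obtain a where a: "a \<in> I" using False by blast
      have "card {a} \<le> card (\<Union>(F ` {a}))" using a by (intro hall) auto
      then obtain x where x: "x \<in> F a" by fastforce
      have "card (I - {a}) < card I" using a fin by (rule card_Diff1_less[rotated])
      moreover have "card K \<le> card (\<Union>((\<lambda>i. F i - {x}) ` K))" if K: "K \<subseteq> I - {a}" for K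
      proof (cases "K = {}")
        case False
        \<comment> \<open>No nonempty proper subfamily is tight, so Hall's inequality is strict for
          \<open>K\<close>; this pays for the loss of \<open>x\<close>.\<close>
        have "K \<subset> I" using K a by blast
        then have "card K < card (\<Union>(F ` K))"
          using noneTight False hall[of K] by (metis le_neq_implies_less psubset_imp_subset)
        moreover have "\<Union>((\<lambda>i. F i - {x}) ` K) = \<Union>(F ` K) - {x}" by auto
        moreover have "card (\<Union>(F ` K)) - 1 \<le> card (\<Union>(F ` K) - {x})"
          using diff_card_le_card_Diff[of "{x}" "\<Union>(F ` K)"] by simp
        ultimately show ?thesis by simp
      qed simp
      ultimately obtain g where g: "inj_on g (I - {a})" "\<forall>i\<in>I - {a}. g i \<in> F i - {x}"
        using less.hyps[of "I - {a}" "\<lambda>i. F i - {x}"] fin finF by blast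
      have "inj_on (g(a := x)) I"
        using g by (auto simp: inj_on_def)
      moreover have "\<forall>i\<in>I. (g(a := x)) i \<in> F i" using g x by auto
      ultimately show ?thesis by blast
    qed
  qed
qed

lemma independent_set_iff:
  assumes "finite_simple_graph V E"
  shows "independent_set V E S \<longleftrightarrow> S \<subseteq> V \<and> (\<forall>u\<in>S. \<forall>v\<in>S. {u, v} \<notin> E)"
proof -
  have "u \<noteq> v" if "{u, v} \<in> E" for u v
    using assms that by (auto simp: finite_simple_graph_def nsets_def)
  then show ?thesis
    unfolding independent_set_def indep_def by blast
qed

lemma card_independent_set_le:
  assumes "finite_simple_graph V E" and "independent_set V E S"
  shows "card S \<le> independence_number V E"
proof -
  have "{S. independent_set V E S} \<subseteq> Pow V" "finite V"
    using assms(1) by (auto simp: independent_set_def finite_simple_graph_def)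
  then have "finite {S. independent_set V E S}" by (meson finite_Pow_iff finite_subset)
  then show ?thesis unfolding independence_number_def using assms(2) by simp
qed

lemma finite_edges:
  assumes "finite_simple_graph V E"
  shows "finite E"
  using assms by (meson finite_imp_finite_nsets finite_simple_graph_def finite_subset)

lemma finite_matchings:
  assumes "finite E"
  shows "finite {M. matching E M}"
  by (rule finite_subset[of _ "Pow E"]) (use assms in \<open>auto simp: matching_def\<close>)

lemma card_matching_le:
  assumes "finite E" and "matching E M"
  shows "card M \<le> matching_number E"
  using assms finite_matchings[OF assms(1)] unfolding matching_number_def by simp

lemma maximum_matching_exists:
  assumes "finite E"
  obtains M where "matching E M" and "card M = matching_number E"
proof -
  have "matching E {}" by (simp add: matching_def)
  then have "Max (card ` {M. matching E M}) \<in> card ` {M. matching E M}"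
    using finite_matchings[OF assms] by (intro Max_in) auto
  then show ?thesis using that unfolding matching_number_def by auto
qed

text \<open>Exchange argument: replacing the neighbors of \<open>A - S\<close> in \<open>S\<close>
  by \<open>A - S\<close> itself leaves an independent set, which cannot be larger than
  \<open>S\<close>.\<close>

lemma card_neighbors_in_maximum_independent_set:
  assumes G: "finite_simple_graph V E"
    and A: "independent_set V E A" and S: "maximum_independent_set V E S"
  shows "card (A - S) \<le> card {u \<in> S. \<exists>a\<in>A - S. {a, u} \<in> E}"
proof -
  define N where "N = {u \<in> S. \<exists>a\<in>A - S. {a, u} \<in> E}"
  have indS: "independent_set V E S" using S by (simp add: maximum_independent_set_def)
  have fin: "finite S" "finite A"
    using G A indS by (auto simp: finite_simple_graph_def independent_set_def intro: finite_subset)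
  have "{u, v} \<in> E \<longleftrightarrow> {v, u} \<in> E" for u v by (simp add: insert_commute)
  then have "independent_set V E ((S - N) \<union> (A - S))"
    using A indS unfolding independent_set_iff[OF G] N_def by blast
  then have "card ((S - N) \<union> (A - S)) \<le> card S"
    using card_independent_set_le[OF G] S by (simp add: maximum_independent_set_def)
  moreover have "card ((S - N) \<union> (A - S)) = card (S - N) + card (A - S)"
    using fin by (intro card_Un_disjoint) auto
  moreover have "card (S - N) = card S - card N" "card N \<le> card S"
    using fin by (auto simp: N_def intro!: card_Diff_subset card_mono)
  ultimately show ?thesis unfolding N_def by linarith
qed

text \<open>This supplies Hall's condition. The set \<open>A\<close> is an arbitrary independent set
  because the induction passes from \<open>A\<close> to \<open>A \<inter> S\<close>.\<close>

lemma card_neighbors_in_Union: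
  assumes G: "finite_simple_graph V E" and "finite \<S>"
    and "\<And>S. S \<in> \<S> \<Longrightarrow> maximum_independent_set V E S"
    and "independent_set V E A"
  shows "card (A - \<Inter>\<S>) \<le> card {u \<in> \<Union>\<S>. \<exists>a\<in>A. {a, u} \<in> E}"
  using assms(2-)
proof (induction \<S> arbitrary: A rule: finite_induct)
  \<comment> \<open>The intersection of the empty family is the whole type, so the left side is
    0.\<close>
  case empty
  then show ?case by simp
next
  case (insert S \<S>)
  define N where "N = {u \<in> S. \<exists>a\<in>A - S. {a, u} \<in> E}"
  define N' where "N' = {u \<in> \<Union>\<S>. \<exists>a\<in>A \<inter> S. {a, u} \<in> E}"
  have S: "maximum_independent_set V E S" using insert.prems(1) by simp
  have indS: "independent_set V E S" using S by (simp add: maximum_independent_set_def)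
  have "T \<subseteq> V" if "T \<in> insert S \<S>" for T
    using insert.prems(1)[OF that] by (simp add: maximum_independent_set_def independent_set_def)
  then have sub: "\<Union>(insert S \<S>) \<subseteq> V" by blast
  have finV: "finite V" using G by (simp add: finite_simple_graph_def)
  have finU: "finite (\<Union>(insert S \<S>))" using sub finV by (rule finite_subset)
  have finA: "finite A"
    using insert.prems(2) finV by (auto simp: independent_set_def intro: finite_subset)
  have indA': "independent_set V E (A \<inter> S)"
    using insert.prems(2) unfolding independent_set_iff[OF G] by blast
  have "A - \<Inter>(insert S \<S>) = (A - S) \<union> (A \<inter> S - \<Inter>\<S>)" by auto
  then have "card (A - \<Inter>(insert S \<S>)) = card (A - S) + card (A \<inter> S - \<Inter>\<S>)"
    using finA by (simp add: card_Un_disjoint disjoint_iff)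
  also have "\<dots> \<le> card N + card N'"
    unfolding N_def N'_def
    using card_neighbors_in_maximum_independent_set[OF G insert.prems(2) S]
      insert.IH[OF _ indA'] insert.prems(1) by (intro add_mono) auto
  also have "\<dots> = card (N \<union> N')"
  proof (rule card_Un_disjoint[symmetric])
    show "finite N" by (rule finite_subset[OF _ finU]) (auto simp: N_def)
    show "finite N'" by (rule finite_subset[OF _ finU]) (auto simp: N'_def)
    \<comment> \<open>\<open>N\<close> lies in \<open>S\<close>, while a vertex of \<open>N'\<close>
      has a neighbor in \<open>S\<close> and hence lies outside \<open>S\<close>.\<close>
    show "N \<inter> N' = {}"
      using indS unfolding N_def N'_def independent_set_iff[OF G] by blast
  qed
  also have "\<dots> \<le> card {u \<in> \<Union>(insert S \<S>). \<exists>a\<in>A. {a, u} \<in> E}"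
    by (intro card_mono finite_subset[OF _ finU]) (auto simp: N_def N'_def)
  finally show ?case .
qed

text \<open>The \<open>card (S - X)\<close> edges found by Hall's theorem avoid the closed
  neighborhood of \<open>X\<close>, so they extend a maximum matching inside it. The subtracted term
  stands on the left to stay within the natural numbers.\<close>

lemma independence_number_matching_bound:
  assumes G: "finite_simple_graph V E" and fin\<S>: "finite \<S>" and ne: "\<S> \<noteq> {}"
    and max: "\<And>S. S \<in> \<S> \<Longrightarrow> maximum_independent_set V E S"
  shows "independence_number V E
           + matching_number (induced_edges E (closed_neighborhood E (\<Inter>\<S>)))
         \<le> matching_number E + card (\<Inter>\<S>)"
proof -
  define X where "X = \<Inter>\<S>"
  define C where "C = closed_neighborhood E X"
  obtain S where S: "S \<in> \<S>" using ne by blast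
  have ind: "independent_set V E T" if "T \<in> \<S>" for T
    using max[OF that] by (simp add: maximum_independent_set_def)
  have finV: "finite V" using G by (simp add: finite_simple_graph_def)
  have sub: "T \<subseteq> V" if "T \<in> \<S>" for T using ind[OF that] by (simp add: independent_set_def)
  have finS: "finite S" using sub[OF S] finV by (rule finite_subset)
  have finU: "finite (\<Union>\<S>)" using sub finV by (meson Sup_least finite_subset)
  have XS: "X \<subseteq> S" using S by (auto simp: X_def)
  \<comment> \<open>Some member of the family contains both \<open>v\<close> and all of
    \<open>X\<close>, so \<open>v\<close> has no neighbor in \<open>X\<close>.\<close>
  have outside: "v \<notin> C" if "v \<in> \<Union>\<S>" "v \<notin> X" for v
  proof -
    obtain T where T: "T \<in> \<S>" "v \<in> T" using \<open>v \<in> \<Union>\<S>\<close> by blast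
    then have "X \<subseteq> T" by (auto simp: X_def)
    then show ?thesis
      using ind[OF T(1)] T(2) \<open>v \<notin> X\<close>
      unfolding independent_set_iff[OF G] C_def closed_neighborhood_def neighborhood_def by blast
  qed
  \<comment> \<open>Partners are sought only in \<open>\<Union>\<S>\<close>, since
    \<open>outside\<close> applies to no other vertices.\<close>
  have "\<exists>f. inj_on f (S - X) \<and> (\<forall>a\<in>S - X. f a \<in> {u \<in> \<Union>\<S>. {a, u} \<in> E})"
  proof (rule hall_marriage)
    fix A assume A: "A \<subseteq> S - X"
    have "independent_set V E A"
      using ind[OF S] A unfolding independent_set_iff[OF G] by blast
    then have "card (A - \<Inter>\<S>) \<le> card {u \<in> \<Union>\<S>. \<exists>a\<in>A. {a, u} \<in> E}"
      using card_neighbors_in_Union[OF G fin\<S> max] by blast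
    moreover have "A - \<Inter>\<S> = A" using A by (auto simp: X_def)
    moreover have "{u \<in> \<Union>\<S>. \<exists>a\<in>A. {a, u} \<in> E} = (\<Union>a\<in>A. {u \<in> \<Union>\<S>. {a, u} \<in> E})"
      by blast
    ultimately show "card A \<le> card (\<Union>a\<in>A. {u \<in> \<Union>\<S>. {a, u} \<in> E})" by simp
  next
    show "finite {u \<in> \<Union>\<S>. {a, u} \<in> E}" for a
      by (rule finite_subset[OF _ finU]) auto
  qed (use finS in simp)
  then obtain f where inj: "inj_on f (S - X)"
    and f: "\<And>a. a \<in> S - X \<Longrightarrow> f a \<in> \<Union>\<S>" "\<And>a. a \<in> S - X \<Longrightarrow> {a, f a} \<in> E"
    by blast
  \<comment> \<open>This rules out \<open>a = f b\<close> when the new edges are shown disjoint, and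
    puts \<open>f a\<close> outside \<open>X\<close>.\<close>
  have fS: "f a \<notin> S" if "a \<in> S - X" for a
    using f(2)[OF that] ind[OF S] that unfolding independent_set_iff[OF G] by blast
  have disj: "{a, f a} \<inter> {b, f b} = {}" if "a \<in> S - X" "b \<in> S - X" "a \<noteq> b" for a b
    using fS[OF that(1)] fS[OF that(2)] inj_onD[OF inj] that by auto
  define M' where "M' = (\<lambda>a. {a, f a}) ` (S - X)"
  have "inj_on (\<lambda>a. {a, f a}) (S - X)"
    using disj by (intro inj_onI) (metis Int_absorb insert_not_empty)
  then have cardM': "card M' = card (S - X)" by (simp add: M'_def card_image)
  have finE: "finite E" using G by (rule finite_edges)
  then have "finite (induced_edges E C)" by (simp add: induced_edges_def)
  then obtain M where M: "matching (induced_edges E C) M"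
    and cardM: "card M = matching_number (induced_edges E C)"
    by (rule maximum_matching_exists)
  have MC: "e \<in> E" "e \<subseteq> C" if "e \<in> M" for e
    using M that by (auto simp: matching_def induced_edges_def)
  have M'C: "e \<inter> C = {}" if e: "e \<in> M'" for e
  proof -
    obtain a where a: "a \<in> S - X" "e = {a, f a}" using e unfolding M'_def by blast
    then have "f a \<notin> X" using fS XS by blast
    then show ?thesis using a f(1) outside S by auto
  qed
  have cross: "e \<inter> e' = {}" if "e \<in> M" "e' \<in> M'" for e e'
    using MC(2)[OF that(1)] M'C[OF that(2)] by blast
  \<comment> \<open>Disjoint edges are distinct only if nonempty; this is what makes the
    cardinalities of \<open>M\<close> and \<open>M'\<close> add up.\<close>
  have M'ne: "e \<noteq> {}" if "e \<in> M'" for e using that by (auto simp: M'_def)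
  have "disjoint M'"
    unfolding M'_def by (intro pairwise_imageI) (use disj in \<open>auto simp: disjnt_def\<close>)
  then have "disjoint (M \<union> M')"
    using M cross by (intro disjoint_union) (auto simp: matching_def)
  moreover have "M \<union> M' \<subseteq> E" using MC f(2) by (auto simp: M'_def)
  ultimately have "card (M \<union> M') \<le> matching_number E"
    using finE by (intro card_matching_le) (auto simp: matching_def)
  moreover have "card (M \<union> M') = card M + card M'"
  proof (rule card_Un_disjoint)
    show "finite M" "finite M'"
      using \<open>M \<union> M' \<subseteq> E\<close> finE by (auto intro: finite_subset)
    show "M \<inter> M' = {}" using cross M'ne by blast
  qed
  moreover have "card (S - X) = card S - card X" "card X \<le> card S"
    using XS finS by (auto intro!: card_Diff_subset card_mono finite_subset[OF XS])
  moreover have "card S = independence_number V E"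
    using max[OF S] by (simp add: maximum_independent_set_def)
  ultimately show ?thesis
    using cardM cardM' unfolding C_def X_def by linarith
qed

theorem theorem1:
  shows "(\<forall>(V :: 'a set) E (S :: nat \<Rightarrow> 'a set) k X.
            finite_simple_graph V E \<and> k \<ge> 1 \<and>
            (\<forall>i\<in>{1..k}. maximum_independent_set V E (S i)) \<and>
            X = (\<Inter>i\<in>{1..k}. S i) \<longrightarrow>
            int (independence_number V E) \<le>
              int (matching_number E) + int (card X)
                - int (matching_number (induced_edges E (closed_neighborhood E X))))
       \<and> (\<exists>(V :: nat set) E (S :: nat \<Rightarrow> nat set) k X.
            finite_simple_graph V E \<and> k \<ge> 1 \<and>
            (\<forall>i\<in>{1..k}. maximum_independent_set V E (S i)) \<and>
            X = (\<Inter>i\<in>{1..k}. S i) \<and>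
            int (independence_number V E) =
              int (matching_number E) + int (card X)
                - int (matching_number (induced_edges E (closed_neighborhood E X))))"
proof (rule conjI)
  show "\<forall>(V :: 'a set) E (S :: nat \<Rightarrow> 'a set) k X.
            finite_simple_graph V E \<and> k \<ge> 1 \<and>
            (\<forall>i\<in>{1..k}. maximum_independent_set V E (S i)) \<and>
            X = (\<Inter>i\<in>{1..k}. S i) \<longrightarrow>
            int (independence_number V E) \<le>
              int (matching_number E) + int (card X)
                - int (matching_number (induced_edges E (closed_neighborhood E X)))"
  proof (intro allI impI, elim conjE)
    fix V :: "'a set" and E and S :: "nat \<Rightarrow> 'a set" and k X
    assume G: "finite_simple_graph V E" and "k \<ge> 1"
      and "\<forall>i\<in>{1..k}. maximum_independent_set V E (S i)"
      and X: "X = (\<Inter>i\<in>{1..k}. S i)"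
    then have "independence_number V E + matching_number (induced_edges E (closed_neighborhood E X))
        \<le> matching_number E + card X"
      using independence_number_matching_bound[OF G, of "S ` {1..k}"] by auto
    then show "int (independence_number V E) \<le>
              int (matching_number E) + int (card X)
                - int (matching_number (induced_edges E (closed_neighborhood E X)))"
      by linarith
  qed
next
  \<comment> \<open>Equality is attained by the empty graph with \<open>k = 1\<close> and
    \<open>X\<close> empty: the independence number and \<open>card X\<close> are 0, and the two
    matching numbers belong to the same edge set and cancel.\<close>
  have graph: "finite_simple_graph ({} :: nat set) {}"
    by (simp add: finite_simple_graph_def)
  have "{S. independent_set ({} :: nat set) {} S} = {{}}"
    by (auto simp: independent_set_def indep_def)
  then have alpha: "independence_number ({} :: nat set) {} = 0"
    by (simp add: independence_number_def)
  have "maximum_independent_set ({} :: nat set) {} {}"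
    by (simp add: maximum_independent_set_def alpha independent_set_def indep_def)
  moreover have "induced_edges {} (closed_neighborhood {} ({} :: nat set)) = {}"
    by (simp add: induced_edges_def)
  ultimately show "\<exists>(V :: nat set) E (S :: nat \<Rightarrow> nat set) k X.
            finite_simple_graph V E \<and> k \<ge> 1 \<and>
            (\<forall>i\<in>{1..k}. maximum_independent_set V E (S i)) \<and>
            X = (\<Inter>i\<in>{1..k}. S i) \<and>
            int (independence_number V E) =
              int (matching_number E) + int (card X)
                - int (matching_number (induced_edges E (closed_neighborhood E X)))"
    using graph alpha
    by (intro exI[of _ "{}"] exI[of _ "\<lambda>_. {}"] exI[of _ "1::nat"]) simp
qed

end
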